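(* Let $d\geq 2$, let $\Omega\subseteq\mathbb{R}^d$ be open and connected, and let $\sigma\in L^1_+(\Omega)$ be a probability density on $\Omega$ (that is, $\sigma\ge 0$ and $\int_\Omega \sigma(x)\,dx=1$). Let $\{X_i\}_{i\geq 1}$ be a sequence of independent, identically distributed random variables with values in $\Omega$, each absolutely continuous with respect to Lebesgue measure with density $\sigma$, and let $\{x_i\}_{i\ge 1}$ denote the random point sequence obtained by sampling them. Let $\phi:[0,\infty)\to\mathbb{R}$ be one of the following radial functions: (i) (Thin-Plate Spline) $\phi(r)=r^{2k}\log(r)$ for $r>0$ and $\phi(0)=0$, for some integer $k\geq 1$; (ii) (Radial Power with noninteger exponent) $\phi(r)=r^{\nu}$, for some real noninteger $\nu>0$. For $n\ge 1$ let $V_n=[\phi_j(x_i)]_{1\leq i,j\leq n}$ be the interpolation matrix, where $\phi_j(x)=\phi(\|x-x_j\|_2)$. Then, for every $n\geq 2$, the matrix $V_n$ is almost surely nonsingular.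
   Context: $\|\cdot\|_2$ is the Euclidean norm on $\mathbb{R}^d$. The centers of the radial functions $\phi_j$ coincide with the sampling points $x_i$, so $V_n$ is the symmetric $n\times n$ matrix with entries $\phi(\|x_i-x_j\|_2)$; its diagonal entries are all $\phi(0)=0$. No polynomial terms are added to the interpolation space. "Almost surely" refers to the joint law of the random variables $X_1,\dots,X_n$, i.e. the product measure on $\Omega^n$ with density $\prod_{i=1}^n\sigma(x_i)$ with respect to Lebesgue measure. *)

theory Defs
  imports "HOL-Probability.Probability" "Jordan_Normal_Form.Matrix"
begin

definition thin_plate_spline :: "nat \<Rightarrow> real \<Rightarrow> real" where
  "thin_plate_spline k r = (if r = 0 then 0 else r ^ (2 * k) * ln r)"

text \<open>Since \<open>0 powr \<nu> = 0\<close>, this is the usual power function on \<open>{0..}\<close> for \<open>\<nu> > 0\<close>.\<close>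

definition radial_power :: "real \<Rightarrow> real \<Rightarrow> real" where
  "radial_power \<nu> r = r powr \<nu>"

definition radial_translate :: "(real \<Rightarrow> real) \<Rightarrow> 'a :: real_normed_vector \<Rightarrow> 'a \<Rightarrow> real" where
  "radial_translate \<phi> c x = \<phi> (norm (x - c))"

text \<open>The points used are \<open>x 0, \<dots>, x (n - 1)\<close>. The qualifier selects the matrices whose
  dimensions are natural numbers rather than types.\<close>

definition interpolation_matrix ::
    "(real \<Rightarrow> real) \<Rightarrow> (nat \<Rightarrow> 'a :: real_normed_vector) \<Rightarrow> nat \<Rightarrow> real Matrix.mat" where
  "interpolation_matrix \<phi> x n = Matrix.mat n n (\<lambda>(i, j). radial_translate \<phi> (x j) (x i))"

end

theory Submission
  imports Defs "HOL-Complex_Analysis.Complex_Analysis" "Jordan_Normal_Form.Determinant"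
begin

text \<open>The points are added one at a time. If the matrix \<open>V\<close> of the first \<open>n\<close> points is invertible and a
  new point \<open>z\<close> is added, then, as all diagonal entries are zero, the enlarged matrix is invertible as soon
  as the quadratic form with coefficient matrix \<open>V\<inverse>\<close> is nonzero at the vector of the values
  \<open>\<phi> (norm (z - x i))\<close> (\<open>invertible_mat_bordered\<close>). The matter is therefore to show that a nonzero symmetric
  quadratic form in these values vanishes only for a null set of \<open>z\<close>
  (\<open>AE_quadratic_form_nonzero\<close>). Since the law of the new point is absolutely continuous
  and the point is independent of the others, the step then holds almost surely.

  Let \<open>z\<close> run along a line. In dimension at least two almost every line of a given direction misses all
  the points, and along it the squared distance to \<open>x i\<close> is \<open>(t - a i)\<^sup>2 + (b i)\<^sup>2\<close> with \<open>b i > 0\<close>; for a generic direction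
  the positions \<open>a i\<close> are distinct. Both profiles are holomorphic functions of the squared distance with a
  branch cut on the negative axis, so the form extends holomorphically in \<open>t\<close> near the real line and has
  countably many zeros there unless it vanishes identically. Identical vanishing is refuted
  by the branch points \<open>a i + \<i> * b i\<close>: the term of \<open>x i\<close> is the only one that jumps across the vertical ray
  above its branch point, and this jump isolates the coefficients that involve \<open>i\<close>
  (\<open>translates_quadratically_independent\<close>). For the powers the jump is proportional to \<open>sin (pi * \<nu> / 2)\<close>, and
  separating the square of the jumping term needs \<open>cos (pi * \<nu> / 2) \<noteq> 0\<close> as well, which together is the
  hypothesis that \<open>\<nu>\<close> is not an integer. For the thin-plate splines the jump comes from the logarithm.\<close>

section \<open>Profiles with a branch cut along a line\<close>

text \<open>The profile \<open>F\<close> has its cut on the negative real axis. In the variable \<open>- z\<close> the cut becomes the positive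
  axis, where the continuations \<open>P\<close> from above and \<open>N\<close> from below are both holomorphic; thus the boundary
  values of \<open>F\<close> at \<open>- m\<close> are the plain values \<open>P m\<close> and \<open>N m\<close> rather than one-sided limits.\<close>

definition branch_jump :: "(complex \<Rightarrow> complex) \<Rightarrow> (complex \<Rightarrow> complex) \<Rightarrow> (complex \<Rightarrow> complex) \<Rightarrow> bool" where
  "branch_jump F P N \<longleftrightarrow>
     F holomorphic_on - \<real>\<^sub>\<le>\<^sub>0 \<and> P holomorphic_on - \<real>\<^sub>\<le>\<^sub>0 \<and> N holomorphic_on - \<real>\<^sub>\<le>\<^sub>0 \<and>
     (\<forall>z. Im z > 0 \<longrightarrow> F z = P (- z)) \<and> (\<forall>z. Im z < 0 \<longrightarrow> F z = N (- z)) \<and>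
     (\<forall>m::real. m > 0 \<longrightarrow> P (of_real m) \<noteq> N (of_real m))"

text \<open>The squared distance from a point moving along a line at unit speed to a fixed point that lies at
  height \<open>b\<close> above the position \<open>a\<close> on the line, continued to complex times. For \<open>b > 0\<close> its values meet the cut
  exactly on the two vertical rays that leave \<open>a \<plusminus> \<i> b\<close> away from the real axis.\<close>

definition line_dist2 :: "real \<Rightarrow> real \<Rightarrow> complex \<Rightarrow> complex" where
  "line_dist2 a b t = (t - of_real a)\<^sup>2 + (of_real b)\<^sup>2"

lemma Re_line_dist2: "Re (line_dist2 a b t) = (Re t - a)\<^sup>2 - (Im t)\<^sup>2 + b\<^sup>2"
  and Im_line_dist2: "Im (line_dist2 a b t) = 2 * (Re t - a) * Im t"
  by (simp_all add: line_dist2_def power2_eq_square)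

lemma line_dist2_holomorphic [holomorphic_intros]:
  "f holomorphic_on A \<Longrightarrow> (\<lambda>t. line_dist2 a b (f t)) holomorphic_on A"
  unfolding line_dist2_def by (intro holomorphic_intros)

lemma line_dist2_of_real: "line_dist2 a b (of_real t) = of_real ((t - a)\<^sup>2 + b\<^sup>2)"
  by (simp add: line_dist2_def)

lemma line_dist2_nonpos_iff:
  assumes "b > 0"
  shows "line_dist2 a b t \<in> \<real>\<^sub>\<le>\<^sub>0 \<longleftrightarrow> Re t = a \<and> b \<le> \<bar>Im t\<bar>"
proof -
  have *: "(Im t)\<^sup>2 \<ge> b\<^sup>2 \<longleftrightarrow> b \<le> \<bar>Im t\<bar>"
    using assms abs_le_square_iff[of b "Im t"] by auto
  have "\<not> ((Re t - a)\<^sup>2 + b\<^sup>2 \<le> 0)"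
    using assms by (smt (verit) zero_le_power2 zero_less_power)
  then show ?thesis
    using * by (auto simp: complex_nonpos_Reals_iff Re_line_dist2 Im_line_dist2)
qed

lemma uminus_line_dist2_nonpos_iff:
  assumes "Im t > 0" "b > 0"
  shows "- line_dist2 a b t \<in> \<real>\<^sub>\<le>\<^sub>0 \<longleftrightarrow> Re t = a \<and> Im t \<le> b"
proof -
  have "(Im t)\<^sup>2 \<le> b\<^sup>2 \<longleftrightarrow> Im t \<le> b"
    using assms abs_le_square_iff[of "Im t" b] by auto
  then show ?thesis
    using assms by (auto simp: complex_nonpos_Reals_iff Re_line_dist2 Im_line_dist2)
qed

lemma branch_comp_holomorphic:
  assumes "F holomorphic_on - \<real>\<^sub>\<le>\<^sub>0" "\<And>t. t \<in> A \<Longrightarrow> g t \<notin> \<real>\<^sub>\<le>\<^sub>0" "g holomorphic_on A"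
  shows "(\<lambda>t. F (g t)) holomorphic_on A"
  using holomorphic_on_compose_gen[OF assms(3,1)] assms(2) by (auto simp: o_def)

lemma isCont_branch_comp:
  assumes "F holomorphic_on - \<real>\<^sub>\<le>\<^sub>0" "g p \<notin> \<real>\<^sub>\<le>\<^sub>0" "isCont g p"
  shows "isCont (\<lambda>t. F (g t)) p"
proof -
  have "isCont F (g p)"
    using assms holomorphic_on_imp_continuous_on[OF assms(1)]
      continuous_on_interior[of "- \<real>\<^sub>\<le>\<^sub>0" F "g p"] interior_open[of "- \<real>\<^sub>\<le>\<^sub>0 :: complex set"]
    by (auto simp: open_Compl)
  then show ?thesis
    using assms(3) by (metis continuous_at_compose o_def isCont_o2)
qed

text \<open>Values on the cut are reached from inside the domain along a horizontal approach.\<close>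

lemma zero_at_side_limit:
  fixes h :: "complex \<Rightarrow> complex" and c :: complex
  assumes "isCont h p" "e > 0" "\<And>r::real. 0 < r \<Longrightarrow> r < e \<Longrightarrow> h (p + c * of_real r) = 0"
  shows "h p = 0"
proof -
  have "isCont (\<lambda>r. h (p + c * complex_of_real r)) 0"
    by (rule isCont_o2[where g = h]) (use assms(1) in \<open>auto intro!: continuous_intros\<close>)
  then have "((\<lambda>r. h (p + c * complex_of_real r)) \<longlongrightarrow> h p) (at_right 0)"
    by (auto simp: continuous_within filterlim_at_split)
  moreover have "\<forall>\<^sub>F r in at_right 0. h (p + c * complex_of_real r) = 0"
    using assms(2,3) by (auto simp: eventually_at_right_field)
  then have "((\<lambda>r. h (p + c * complex_of_real r)) \<longlongrightarrow> 0) (at_right 0)"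
    by (simp add: tendsto_eventually)
  ultimately show ?thesis
    using tendsto_unique[OF trivial_limit_at_right_real] by blast
qed

lemma open_strip: "open {t. \<bar>Re t - a\<bar> < e}"
  by (intro open_Collect_less continuous_intros)

lemma convex_strip: "convex {t. \<bar>Re t - a\<bar> < e}"
proof -
  have "{t. \<bar>Re t - a\<bar> < e} = {t. Re t < a + e} \<inter> {t. Re t > a - e}" by auto
  then show ?thesis by (simp add: convex_Int convex_halfspace_Re_lt convex_halfspace_Re_gt)
qed

lemma islimpt_segment:
  fixes p c :: complex and e :: real
  assumes "e > 0" "c \<noteq> 0"
  shows "p islimpt {p + c * of_real r | r::real. 0 < r \<and> r < e}"
proof (rule islimptI)
  fix T :: "complex set" assume "p \<in> T" "open T"
  then obtain d where d: "d > 0" "ball p d \<subseteq> T" by (meson openE)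
  define r where "r = min (e/2) (d / (2 * norm c))"
  have r: "0 < r" "r < e" "r \<le> d / (2 * norm c)" using assms d by (auto simp: r_def)
  have "norm c * r \<le> d / 2" using r(3) assms(2) by (simp add: field_simps)
  then have "p + c * of_real r \<in> ball p d"
    using d(1) r(1) by (simp add: dist_norm norm_mult)
  then show "\<exists>y\<in>{p + c * of_real r | r::real. 0 < r \<and> r < e}. y \<in> T \<and> y \<noteq> p"
    using d r assms by (intro bexI[of _ "p + c * of_real r"]) auto
qed

text \<open>The part of a vertical strip that avoids the two rays is starlike about \<open>a\<close>, so the relation
  persists from the real interval up to both sides of the upper ray. On the two sides \<open>F\<close> has the values
  \<open>P\<close> and \<open>N\<close>, while the coefficients \<open>\<alpha>\<close>, \<open>\<beta>\<close>, \<open>\<gamma>\<close> agree; the difference of the two quadratic equations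
  is divisible by \<open>P - N\<close>, which does not vanish.\<close>

lemma jump_across_ray:
  fixes a b \<epsilon> y :: real
  assumes bj: "branch_jump F P N" and pos: "b > 0" "\<epsilon> > 0" "y > b"
    and hol: "\<beta> holomorphic_on {t. \<bar>Re t - a\<bar> < \<epsilon>}" "\<gamma> holomorphic_on {t. \<bar>Re t - a\<bar> < \<epsilon>}"
    and zero: "\<And>x::real. \<bar>x - a\<bar> < \<epsilon> \<Longrightarrow>
       \<alpha> * (F (line_dist2 a b x))\<^sup>2 + \<beta> x * F (line_dist2 a b x) + \<gamma> x = 0"
  shows "\<alpha> * (P (of_real (y\<^sup>2 - b\<^sup>2)) + N (of_real (y\<^sup>2 - b\<^sup>2))) + \<beta> (Complex a y) = 0"
proof -
  define S where "S = {t. \<bar>Re t - a\<bar> < \<epsilon>}"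
  define D where "D = {t. \<bar>Re t - a\<bar> < \<epsilon>} - {t. Re t = a \<and> b \<le> \<bar>Im t\<bar>}"
  define q where "q = line_dist2 a b"
  note F = bj[unfolded branch_jump_def]
  have hS: "\<beta> holomorphic_on S" "\<gamma> holomorphic_on S" using hol by (auto simp: S_def)
  have opS: "open S" unfolding S_def by (rule open_strip)
  have opD: "open D"
    unfolding D_def by (intro open_Diff open_strip closed_Collect_conj closed_Collect_eq closed_Collect_le continuous_intros)
  have "starlike D"
    unfolding starlike_def
  proof (intro bexI[of _ "of_real a"] ballI subsetI)
    show "of_real a \<in> D" using pos by (auto simp: D_def)
    fix t z assume t: "t \<in> D" and z: "z \<in> closed_segment (complex_of_real a) t"
    then obtain u where u: "0 \<le> u" "u \<le> 1" "z = (1 - u) *\<^sub>R of_real a + u *\<^sub>R t"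
      by (auto simp: in_segment)
    have Rz: "Re z - a = u * (Re t - a)" "Im z = u * Im t"
      unfolding u(3) by (simp_all add: algebra_simps)
    have ab: "\<bar>Re z - a\<bar> \<le> \<bar>Re t - a\<bar>" "\<bar>Im z\<bar> \<le> \<bar>Im t\<bar>"
      using u(1,2) by (auto simp: Rz abs_mult intro: mult_left_le_one_le)
    show "z \<in> D"
    proof (rule ccontr)
      assume "z \<notin> D"
      then have z: "Re z = a" "b \<le> \<bar>Im z\<bar>" using ab t by (auto simp: D_def)
      then have "Re t = a \<or> u = 0" using Rz by auto
      moreover have "u \<noteq> 0" using z pos Rz by auto
      ultimately show False using t z ab by (auto simp: D_def)
    qed
  qed
  then have conD: "connected D" by (rule starlike_imp_connected)
  have DS: "D \<subseteq> S" by (auto simp: D_def S_def)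
  define f where "f t = \<alpha> * (F (q t))\<^sup>2 + \<beta> t * F (q t) + \<gamma> t" for t
  have hF: "(\<lambda>t. F (q t)) holomorphic_on D"
  proof (rule branch_comp_holomorphic[where g = q])
    show "q t \<notin> \<real>\<^sub>\<le>\<^sub>0" if "t \<in> D" for t
      using that line_dist2_nonpos_iff[OF pos(1), of a t] by (auto simp: D_def q_def)
  qed (use F in \<open>auto simp: q_def intro!: holomorphic_intros\<close>)
  have fD: "f holomorphic_on D" unfolding f_def
    by (intro holomorphic_intros hF holomorphic_on_subset[OF hS(1) DS] holomorphic_on_subset[OF hS(2) DS])
  have f0: "f t = 0" if "t \<in> D" for t
  proof (rule analytic_continuation[OF fD opD conD])
    show "{of_real a + 1 * of_real r | r::real. 0 < r \<and> r < \<epsilon>} \<subseteq> D" using pos by (auto simp: D_def)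
    show "of_real a \<in> D" using pos by (auto simp: D_def)
    show "complex_of_real a islimpt {of_real a + 1 * of_real r | r::real. 0 < r \<and> r < \<epsilon>}"
      by (rule islimpt_segment) (use pos in auto)
    show "f z = 0" if z: "z \<in> {of_real a + 1 * of_real r | r::real. 0 < r \<and> r < \<epsilon>}" for z
    proof -
      from z obtain r where r: "z = of_real (a + r)" "0 < r" "r < \<epsilon>" by auto
      then show ?thesis using zero[of "a + r"] by (simp add: f_def q_def)
    qed
  qed (use that in auto)
  define p where "p = Complex a y"
  define w where "w = complex_of_real (y\<^sup>2 - b\<^sup>2)"
  have "(y::real)\<^sup>2 > b\<^sup>2" using pos by (simp add: power_strict_mono)
  then have wpos: "y\<^sup>2 - b\<^sup>2 > 0" by simp
  have qp: "- q p = w"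
    by (rule complex_eqI) (simp_all add: q_def p_def w_def Re_line_dist2 Im_line_dist2)
  have wn: "- q p \<notin> \<real>\<^sub>\<le>\<^sub>0" using wpos by (simp add: qp w_def del: of_real_diff of_real_power)
  have cq: "isCont (\<lambda>t. - q t) p" unfolding q_def line_dist2_def by (intro continuous_intros)
  have pS: "p \<in> S" using pos by (simp add: S_def p_def)
  have c\<beta>: "isCont \<beta> p" and c\<gamma>: "isCont \<gamma> p"
    using hS holomorphic_on_imp_continuous_on continuous_on_eq_continuous_at[OF opS] pS by blast+
  have side: "\<alpha> * (Q w)\<^sup>2 + \<beta> p * Q w + \<gamma> p = 0"
    if Q: "Q holomorphic_on - \<real>\<^sub>\<le>\<^sub>0" and s: "s = 1 \<or> s = -1"
      and FQ: "\<And>z. s * Im z > 0 \<Longrightarrow> F z = Q (- z)" for Q and s :: real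
  proof -
    define h where "h t = \<alpha> * (Q (- q t))\<^sup>2 + \<beta> t * Q (- q t) + \<gamma> t" for t
    have "isCont h p" unfolding h_def
      by (intro continuous_intros isCont_branch_comp[OF Q] wn cq c\<beta> c\<gamma>)
    moreover have "h (p + of_real s * of_real r) = 0" if r: "0 < r" "r < \<epsilon>" for r
    proof -
      let ?t = "p + of_real s * of_real r"
      have "?t \<in> D" using s r by (auto simp: D_def p_def)
      moreover have "s * Im (q ?t) > 0"
        using s r pos by (auto simp: q_def Im_line_dist2 p_def)
      ultimately show ?thesis using FQ[of "q ?t"] f0[of ?t] by (simp add: h_def f_def)
    qed
    ultimately have "h p = 0" by (rule zero_at_side_limit[OF _ pos(2)])
    then show ?thesis by (simp add: h_def qp)
  qed
  have "\<alpha> * (P w)\<^sup>2 + \<beta> p * P w + \<gamma> p = 0" "\<alpha> * (N w)\<^sup>2 + \<beta> p * N w + \<gamma> p = 0"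
    using side[of P 1] side[of N "-1"] F by auto
  moreover have "(P w - N w) * (\<alpha> * (P w + N w) + \<beta> p)
      = (\<alpha> * (P w)\<^sup>2 + \<beta> p * P w + \<gamma> p) - (\<alpha> * (N w)\<^sup>2 + \<beta> p * N w + \<gamma> p)"
    by (simp add: algebra_simps power2_eq_square)
  ultimately have "(P w - N w) * (\<alpha> * (P w + N w) + \<beta> p) = 0" by simp
  moreover have "P w \<noteq> N w" using F wpos unfolding w_def by blast
  ultimately show ?thesis by (simp add: p_def w_def)
qed

text \<open>This separates the constant coefficient of the relation obtained on the ray. There the relation
  involves \<open>G\<close> at \<open>- line_dist2 a b\<close>, which has its cut on the complementary segment below
  \<open>a + \<i> b\<close>. The upper half strip without that segment is starlike about a point of the ray, so the relation
  reaches both sides of the segment, where \<open>\<beta>\<close> is continuous and \<open>G\<close> jumps.\<close>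

lemma jump_across_segment:
  fixes a b \<epsilon> :: real
  assumes bj: "branch_jump G P N" and pos: "b > 0" "\<epsilon> > 0"
    and hol: "\<beta> holomorphic_on {t. \<bar>Re t - a\<bar> < \<epsilon>}"
    and zero: "\<And>y::real. y > b \<Longrightarrow> \<alpha> * G (of_real (y\<^sup>2 - b\<^sup>2)) + \<beta> (Complex a y) = 0"
  shows "\<alpha> = 0"
proof -
  define S where "S = {t. \<bar>Re t - a\<bar> < \<epsilon>}"
  define D where "D = {t. \<bar>Re t - a\<bar> < \<epsilon>} \<inter> {t. 0 < Im t} - {t. Re t = a \<and> Im t \<le> b}"
  define q where "q = line_dist2 a b"
  note G = bj[unfolded branch_jump_def]
  have hS: "\<beta> holomorphic_on S" using hol by (auto simp: S_def)
  have opS: "open S" unfolding S_def by (rule open_strip)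
  have opD: "open D"
    unfolding D_def by (intro open_Diff open_Int open_strip open_Collect_less closed_Collect_conj closed_Collect_eq closed_Collect_le continuous_intros)
  define apex where "apex = Complex a (2 * b)"
  have apexD: "apex \<in> D" using pos by (auto simp: D_def apex_def)
  \<comment> \<open>The apex lies above \<open>b\<close>, so a segment from it stays above every level below both of its ends.\<close>
  have "starlike D"
    unfolding starlike_def
  proof (intro bexI[OF _ apexD] ballI subsetI)
    fix t z assume t: "t \<in> D" and z: "z \<in> closed_segment apex t"
    then obtain u where u: "0 \<le> u" "u \<le> 1" "z = (1 - u) *\<^sub>R apex + u *\<^sub>R t"
      by (auto simp: in_segment)
    have Rz: "Re z - a = u * (Re t - a)" "Im z = (1 - u) * (2 * b) + u * Im t"
      unfolding u(3) by (simp_all add: algebra_simps apex_def)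
    have ab: "\<bar>Re z - a\<bar> \<le> \<bar>Re t - a\<bar>"
      using u(1,2) by (auto simp: Rz abs_mult intro: mult_left_le_one_le)
    have gt: "Im z > m" if "2 * b > m" "Im t > m" for m
    proof -
      have "(1 - u) * m + u * m < Im z"
      proof (cases "u = 0")
        case False
        then have "u * m < u * Im t" using that u by simp
        moreover have "(1 - u) * m \<le> (1 - u) * (2 * b)" using that u by (intro mult_left_mono) auto
        ultimately show ?thesis using Rz by linarith
      qed (use that Rz in auto)
      then show ?thesis by (simp add: algebra_simps)
    qed
    show "z \<in> D"
    proof (cases "Re z = a")
      case True
      then have "Re t = a \<or> u = 0" using Rz by auto
      then show ?thesis
      proof
        assume "Re t = a"
        then have "Im t > b" using t by (auto simp: D_def)
        then have "Im z > b" using gt[of b] pos by simp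
        then show ?thesis using True pos by (auto simp: D_def)
      next
        assume "u = 0" then show ?thesis using u apexD by simp
      qed
    next
      case False
      then show ?thesis using ab t gt[of 0] pos by (auto simp: D_def)
    qed
  qed
  then have conD: "connected D" by (rule starlike_imp_connected)
  have DS: "D \<subseteq> S" by (auto simp: D_def S_def)
  define f where "f t = \<alpha> * G (- q t) + \<beta> t" for t
  have hG: "(\<lambda>t. G (- q t)) holomorphic_on D"
  proof (rule branch_comp_holomorphic[where g = "\<lambda>t. - q t"])
    show "- q t \<notin> \<real>\<^sub>\<le>\<^sub>0" if "t \<in> D" for t
      using that uminus_line_dist2_nonpos_iff[of t b a] pos by (auto simp: D_def q_def)
  qed (use G in \<open>auto simp: q_def intro!: holomorphic_intros\<close>)
  have fD: "f holomorphic_on D" unfolding f_def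
    by (intro holomorphic_intros hG holomorphic_on_subset[OF hS DS])
  have f0: "f t = 0" if "t \<in> D" for t
  proof (rule analytic_continuation[OF fD opD conD])
    show "{apex + \<i> * of_real r | r::real. 0 < r \<and> r < 1} \<subseteq> D" using pos by (auto simp: D_def apex_def)
    show "apex \<in> D" by (rule apexD)
    show "apex islimpt {apex + \<i> * of_real r | r::real. 0 < r \<and> r < 1}"
      by (rule islimpt_segment) auto
    show "f z = 0" if z: "z \<in> {apex + \<i> * of_real r | r::real. 0 < r \<and> r < 1}" for z
    proof -
      from z obtain r where r: "z = Complex a (2 * b + r)" "0 < r" "r < 1"
        by (auto simp: apex_def complex_eq_iff)
      have "- q z = of_real ((2 * b + r)\<^sup>2 - b\<^sup>2)"
        by (rule complex_eqI) (simp_all add: r q_def Re_line_dist2 Im_line_dist2)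
      then show ?thesis using zero[of "2 * b + r"] r pos by (simp add: f_def)
    qed
  qed (use that in auto)
  define p where "p = Complex a (b / 2)"
  define w where "w = complex_of_real (b\<^sup>2 - (b / 2)\<^sup>2)"
  have wpos: "b\<^sup>2 - (b / 2)\<^sup>2 > 0" using pos by (simp add: field_simps power2_eq_square)
  have qp: "q p = w"
    by (rule complex_eqI) (simp_all add: q_def p_def w_def Re_line_dist2 Im_line_dist2)
  have wn: "q p \<notin> \<real>\<^sub>\<le>\<^sub>0" using wpos by (simp add: qp w_def del: of_real_diff of_real_power)
  have cq: "isCont (\<lambda>t. q t) p" unfolding q_def line_dist2_def by (intro continuous_intros)
  have pS: "p \<in> S" using pos by (simp add: S_def p_def)
  have c\<beta>: "isCont \<beta> p"
    using hS holomorphic_on_imp_continuous_on continuous_on_eq_continuous_at[OF opS] pS by blast+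
  have side: "\<alpha> * Q w + \<beta> p = 0"
    if Q: "Q holomorphic_on - \<real>\<^sub>\<le>\<^sub>0" and s: "s = 1 \<or> s = -1"
      and GQ: "\<And>z. s * Im z > 0 \<Longrightarrow> G z = Q (- z)" for Q and s :: real
  proof -
    define h where "h t = \<alpha> * Q (q t) + \<beta> t" for t
    have "isCont h p" unfolding h_def
      by (intro continuous_intros isCont_branch_comp[OF Q] wn cq c\<beta>)
    \<comment> \<open>Right of the segment the imaginary part of \<open>- line_dist2 a b\<close> is negative, hence the reversed sign.\<close>
    moreover have "h (p + of_real (- s) * of_real r) = 0" if r: "0 < r" "r < \<epsilon>" for r
    proof -
      let ?t = "p + of_real (- s) * of_real r"
      have "?t \<in> D" using s r pos by (auto simp: D_def p_def)
      moreover have "s * Im (- q ?t) > 0"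
        using s r pos by (auto simp: q_def Im_line_dist2 p_def)
      ultimately show ?thesis using GQ[of "- q ?t"] f0[of ?t] by (simp add: h_def f_def)
    qed
    ultimately have "h p = 0" by (rule zero_at_side_limit[OF _ pos(2)])
    then show ?thesis by (simp add: h_def qp)
  qed
  have "\<alpha> * P w + \<beta> p = 0" "\<alpha> * N w + \<beta> p = 0"
    using side[of P 1] side[of N "-1"] G by auto
  then have "\<alpha> * P w + \<beta> p = \<alpha> * N w + \<beta> p" by simp
  then have "\<alpha> * (P w - N w) = 0" by (simp add: algebra_simps)
  moreover have "P w \<noteq> N w" using G wpos unfolding w_def by blast
  ultimately show ?thesis by simp
qed

lemma zero_on_strip_if_zero_on_ray:
  assumes "\<beta> holomorphic_on {t. \<bar>Re t - a\<bar> < \<epsilon>}" "\<epsilon> > 0"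
    and "\<And>y::real. y > b \<Longrightarrow> \<beta> (Complex a y) = 0" and "\<bar>Re t - a\<bar> < \<epsilon>"
  shows "\<beta> t = 0"
proof (rule analytic_continuation[OF assms(1) open_strip convex_connected[OF convex_strip]])
  let ?U = "{Complex a b + \<i> * of_real r | r::real. 0 < r \<and> r < 1}"
  show "?U \<subseteq> {t. \<bar>Re t - a\<bar> < \<epsilon>}" using assms(2) by auto
  show "Complex a b \<in> {t. \<bar>Re t - a\<bar> < \<epsilon>}" using assms(2) by auto
  show "Complex a b islimpt ?U" by (rule islimpt_segment) auto
  show "\<beta> z = 0" if "z \<in> ?U" for z
  proof -
    from that obtain r where r: "z = Complex a (b + r)" "0 < r"
      by (auto simp: complex_eq_iff)
    then show ?thesis using assms(3)[of "b + r"] by simp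
  qed
qed (use assms in auto)

lemma branch_comp_holomorphic_on_strip:
  assumes "F holomorphic_on - \<real>\<^sub>\<le>\<^sub>0" "b > 0" "\<epsilon> \<le> \<bar>a' - a\<bar>"
  shows "(\<lambda>t. F (line_dist2 a' b t)) holomorphic_on {t. \<bar>Re t - a\<bar> < \<epsilon>}"
  by (rule branch_comp_holomorphic[OF assms(1)])
    (use assms line_dist2_nonpos_iff[of b a'] in \<open>auto intro!: holomorphic_intros\<close>)

lemma separating_radius:
  fixes a :: "'i \<Rightarrow> real"
  assumes "finite J" "inj_on a J" "i \<in> J"
  obtains \<epsilon> where "\<epsilon> > 0" "\<And>j. j \<in> J - {i} \<Longrightarrow> \<epsilon> \<le> \<bar>a j - a i\<bar>"
proof
  define \<epsilon> where "\<epsilon> = Min (insert 1 ((\<lambda>j. \<bar>a j - a i\<bar>) ` (J - {i})))"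
  show "\<epsilon> > 0" using assms by (auto simp: \<epsilon>_def inj_on_def)
  show "\<epsilon> \<le> \<bar>a j - a i\<bar>" if "j \<in> J - {i}" for j
    unfolding \<epsilon>_def using that assms by (intro Min_le) auto
qed

text \<open>Distinct positions \<open>a j\<close> put the rays on distinct vertical lines, so near the ray of index \<open>i\<close> only
  the term of index \<open>i\<close> can jump.\<close>

lemma translates_linearly_independent:
  fixes a b :: "'i \<Rightarrow> real" and c :: "'i \<Rightarrow> complex"
  assumes bj: "branch_jump F P N"
    and J: "finite J" "inj_on a J" "\<And>j. j \<in> J \<Longrightarrow> b j > 0"
    and zero: "\<And>x::real. (\<Sum>j\<in>J. c j * F (line_dist2 (a j) (b j) x)) = 0"
    and i: "i \<in> J"
  shows "c i = 0"
proof -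
  obtain \<epsilon> where \<epsilon>: "\<epsilon> > 0" "\<And>j. j \<in> J - {i} \<Longrightarrow> \<epsilon> \<le> \<bar>a j - a i\<bar>"
    using separating_radius[OF J(1,2) i] by blast
  have F: "F holomorphic_on - \<real>\<^sub>\<le>\<^sub>0" using bj by (simp add: branch_jump_def)
  define \<gamma> where "\<gamma> t = (\<Sum>j\<in>J - {i}. c j * F (line_dist2 (a j) (b j) t))" for t
  have "0 * (P (of_real ((b i + 1)\<^sup>2 - (b i)\<^sup>2)) + N (of_real ((b i + 1)\<^sup>2 - (b i)\<^sup>2)))
      + (\<lambda>_. c i) (Complex (a i) (b i + 1)) = 0"
  proof (rule jump_across_ray[OF bj, where \<epsilon> = \<epsilon> and \<gamma> = \<gamma>])
    show "\<gamma> holomorphic_on {t. \<bar>Re t - a i\<bar> < \<epsilon>}" unfolding \<gamma>_def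
      by (intro holomorphic_intros branch_comp_holomorphic_on_strip[OF F]) (use J \<epsilon> in auto)
    show "0 * (F (line_dist2 (a i) (b i) x))\<^sup>2 + c i * F (line_dist2 (a i) (b i) x) + \<gamma> x = 0" for x :: real
      using zero[of x] i J(1) by (simp add: \<gamma>_def sum.remove)
  qed (use J i \<epsilon> in \<open>auto intro: holomorphic_intros\<close>)
  then show ?thesis by simp
qed

lemma open_horizontal_strip: "open {t. \<bar>Im t\<bar> < e}"
  by (intro open_Collect_less continuous_intros)

lemma convex_horizontal_strip: "convex {t. \<bar>Im t\<bar> < e}"
proof -
  have "{t. \<bar>Im t\<bar> < e} = {t. Im t < e} \<inter> {t. Im t > - e}" by auto
  then show ?thesis by (simp add: convex_Int convex_halfspace_Im_lt convex_halfspace_Im_gt)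
qed

lemma fsigma_horizontal_strip: "fsigma {t. \<bar>Im t\<bar> < e}"
proof -
  define F where "F n = {t. \<bar>Im t\<bar> \<le> e - inverse (real (Suc n))}" for n
  have "closed (F n)" for n
    unfolding F_def by (intro closed_Collect_le continuous_intros)
  moreover have "{t. \<bar>Im t\<bar> < e} = (\<Union>n. F n)"
  proof (intro equalityI subsetI)
    fix t assume "t \<in> {t. \<bar>Im t\<bar> < e}"
    then obtain n where "inverse (real (Suc n)) < e - \<bar>Im t\<bar>"
      using reals_Archimedean[of "e - \<bar>Im t\<bar>"] by auto
    then show "t \<in> (\<Union>n. F n)" by (auto simp: F_def intro!: exI[of _ n])
  next
    fix t assume "t \<in> (\<Union>n. F n)"
    then obtain n where "\<bar>Im t\<bar> \<le> e - inverse (real (Suc n))" by (auto simp: F_def)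
    moreover have "inverse (real (Suc n)) > 0" by (rule positive_imp_inverse_positive) simp
    ultimately have "\<bar>Im t\<bar> < e" by linarith
    then show "t \<in> {t. \<bar>Im t\<bar> < e}" by simp
  qed
  ultimately show ?thesis by (metis fsigma.intros)
qed

lemma branch_comp_holomorphic_on_horizontal_strip:
  assumes "F holomorphic_on - \<real>\<^sub>\<le>\<^sub>0" "b > 0" "e \<le> b"
  shows "(\<lambda>t. F (line_dist2 a b t)) holomorphic_on {t. \<bar>Im t\<bar> < e}"
  by (rule branch_comp_holomorphic[OF assms(1)])
    (use assms line_dist2_nonpos_iff[of b a] in \<open>auto intro!: holomorphic_intros\<close>)

lemma zero_on_real_line_if_zero_on_interval:
  fixes f :: "complex \<Rightarrow> complex" and x a e :: real
  assumes f: "f holomorphic_on {t. \<bar>Im t\<bar> < d}" and "d > 0" "e > 0"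
    and zero: "\<And>x::real. \<bar>x - a\<bar> < e \<Longrightarrow> f x = 0"
  shows "f x = 0"
proof (rule analytic_continuation[OF f open_horizontal_strip convex_connected[OF convex_horizontal_strip]])
  let ?U = "{of_real a + 1 * of_real r | r::real. 0 < r \<and> r < e}"
  show "?U \<subseteq> {t. \<bar>Im t\<bar> < d}" using assms by auto
  show "complex_of_real a \<in> {t. \<bar>Im t\<bar> < d}" using assms by auto
  show "complex_of_real a islimpt ?U" by (rule islimpt_segment) (use assms in auto)
  show "f z = 0" if "z \<in> ?U" for z
  proof -
    from that obtain r where r: "z = of_real (a + r)" "0 < r" "r < e" by auto
    then show ?thesis using zero[of "a + r"] by simp
  qed
qed (use assms in auto)

lemma lower_bound_radius:
  fixes b :: "'i \<Rightarrow> real"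
  assumes "finite J" "\<And>j. j \<in> J \<Longrightarrow> b j > 0"
  obtains e where "e > 0" "\<And>j. j \<in> J \<Longrightarrow> e \<le> b j"
proof
  show "Min (insert 1 (b ` J)) > 0" using assms by auto
  show "Min (insert 1 (b ` J)) \<le> b j" if "j \<in> J" for j using that assms by (intro Min_le) auto
qed

text \<open>Sorted by powers of the term with index \<open>i\<close>, the relation is quadratic with the constant leading
  coefficient \<open>A i i\<close> and a linear coefficient that is twice a combination of the other terms. The jump
  across the ray of index \<open>i\<close> links these two through \<open>P + N\<close>. As this sum has a branch cut of its own, the
  jump across the segment below the ray kills \<open>A i i\<close>, and then linear independence kills the combination.\<close>

lemma translates_quadratically_independent:
  fixes a b :: "'i \<Rightarrow> real" and A :: "'i \<Rightarrow> 'i \<Rightarrow> complex"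
  assumes bj: "branch_jump F P N" and bj': "branch_jump (\<lambda>z. P z + N z) P' N'"
    and J: "finite J" "inj_on a J" "\<And>j. j \<in> J \<Longrightarrow> b j > 0"
    and sym: "\<And>i j. i \<in> J \<Longrightarrow> j \<in> J \<Longrightarrow> A i j = A j i"
    and zero: "\<And>x::real. (\<Sum>i\<in>J. \<Sum>j\<in>J. A i j * F (line_dist2 (a i) (b i) x) * F (line_dist2 (a j) (b j) x)) = 0"
    and i: "i \<in> J" and j: "j \<in> J"
  shows "A i j = 0"
proof -
  obtain \<epsilon> where \<epsilon>: "\<epsilon> > 0" "\<And>j. j \<in> J - {i} \<Longrightarrow> \<epsilon> \<le> \<bar>a j - a i\<bar>"
    using separating_radius[OF J(1,2) i] by blast
  obtain d where d: "d > 0" "\<And>j. j \<in> J \<Longrightarrow> d \<le> b j"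
    using lower_bound_radius[OF J(1), of b] J(3) by blast
  have F: "F holomorphic_on - \<real>\<^sub>\<le>\<^sub>0" using bj by (simp add: branch_jump_def)
  define \<Phi> where "\<Phi> j t = F (line_dist2 (a j) (b j) t)" for j t
  define K where "K = J - {i}"
  have K: "finite K" "i \<notin> K" "J = insert i K" "K \<subseteq> J" using J i by (auto simp: K_def)
  define \<beta> where "\<beta> t = (\<Sum>j\<in>K. 2 * A i j * \<Phi> j t)" for t
  define \<gamma> where "\<gamma> t = (\<Sum>k\<in>K. \<Sum>j\<in>K. A k j * \<Phi> k t * \<Phi> j t)" for t
  have \<Phi>hol: "\<Phi> j holomorphic_on {t. \<bar>Re t - a i\<bar> < \<epsilon>}" if "j \<in> K" for j
    unfolding \<Phi>_def by (rule branch_comp_holomorphic_on_strip[OF F]) (use J \<epsilon> that in \<open>auto simp: K_def\<close>)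
  have \<beta>hol: "\<beta> holomorphic_on {t. \<bar>Re t - a i\<bar> < \<epsilon>}"
    unfolding \<beta>_def by (intro holomorphic_intros \<Phi>hol)
  have ray: "A i i * (P (of_real (y\<^sup>2 - (b i)\<^sup>2)) + N (of_real (y\<^sup>2 - (b i)\<^sup>2))) + \<beta> (Complex (a i) y) = 0"
    if y: "y > b i" for y
  proof (rule jump_across_ray[OF bj _ \<epsilon>(1) y \<beta>hol, where \<gamma> = \<gamma>])
    show "\<gamma> holomorphic_on {t. \<bar>Re t - a i\<bar> < \<epsilon>}"
      unfolding \<gamma>_def by (intro holomorphic_intros \<Phi>hol)
    show "A i i * (F (line_dist2 (a i) (b i) x))\<^sup>2 + \<beta> x * F (line_dist2 (a i) (b i) x) + \<gamma> x = 0" for x :: real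
    proof -
      have "(\<Sum>k\<in>K. A k i * \<Phi> k x * \<Phi> i x) = (\<Sum>k\<in>K. A i k * \<Phi> i x * \<Phi> k x)"
        using sym i K by (intro sum.cong) auto
      then have "(\<Sum>k\<in>J. \<Sum>j\<in>J. A k j * \<Phi> k x * \<Phi> j x)
        = A i i * (\<Phi> i x)\<^sup>2 + 2 * (\<Sum>k\<in>K. A i k * \<Phi> i x * \<Phi> k x) + \<gamma> x"
        using K by (simp add: \<gamma>_def sum.distrib power2_eq_square)
      moreover have "2 * (\<Sum>k\<in>K. A i k * \<Phi> i x * \<Phi> k x) = \<beta> x * \<Phi> i x"
        by (simp add: \<beta>_def sum_distrib_left sum_distrib_right mult_ac)
      ultimately show ?thesis using zero[of x] by (simp add: \<Phi>_def)
    qed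
  qed (use J i in auto)
  have Aii: "A i i = 0"
    by (rule jump_across_segment[OF bj' _ \<epsilon>(1) \<beta>hol ray]) (use J i in auto)
  have \<beta>0: "\<beta> t = 0" if "\<bar>Re t - a i\<bar> < \<epsilon>" for t
    by (rule zero_on_strip_if_zero_on_ray[OF \<beta>hol \<epsilon>(1) _ that, where b = "b i"]) (use ray Aii in auto)
  have \<beta>line: "\<beta> (of_real x) = 0" for x :: real
  proof (rule zero_on_real_line_if_zero_on_interval[OF _ d(1) \<epsilon>(1), where a = "a i"])
    show "\<beta> holomorphic_on {t. \<bar>Im t\<bar> < d}" unfolding \<beta>_def \<Phi>_def
      by (intro holomorphic_intros branch_comp_holomorphic_on_horizontal_strip[OF F]) (use J d K in auto)
  qed (use \<beta>0 in auto)
  have "2 * A i j = 0" if "j \<in> K" for j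
    by (rule translates_linearly_independent[OF bj, where J = K and a = a and b = b])
      (use \<beta>line that K J in \<open>auto simp: \<beta>_def \<Phi>_def inj_on_subset\<close>)
  then show ?thesis using Aii j K by auto
qed

text \<open>All terms are holomorphic on a horizontal strip about the real axis, so either the zeros are
  countable or the form vanishes on the whole line, which quadratic independence forbids.\<close>

lemma countable_zeros_on_line:
  fixes a b :: "'i \<Rightarrow> real" and A :: "'i \<Rightarrow> 'i \<Rightarrow> complex"
  assumes bj: "branch_jump F P N" and bj': "branch_jump (\<lambda>z. P z + N z) P' N'"
    and J: "finite J" "inj_on a J" "\<And>j. j \<in> J \<Longrightarrow> b j > 0"
    and sym: "\<And>i j. i \<in> J \<Longrightarrow> j \<in> J \<Longrightarrow> A i j = A j i"
    and nz: "i \<in> J" "j \<in> J" "A i j \<noteq> 0"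
  shows "countable {x::real. (\<Sum>i\<in>J. \<Sum>j\<in>J. A i j * F (line_dist2 (a i) (b i) x) * F (line_dist2 (a j) (b j) x)) = 0}"
proof -
  obtain d where d: "d > 0" "\<And>j. j \<in> J \<Longrightarrow> d \<le> b j"
    using lower_bound_radius[OF J(1), of b] J(3) by blast
  have F: "F holomorphic_on - \<real>\<^sub>\<le>\<^sub>0" using bj by (simp add: branch_jump_def)
  define H where "H = {t. \<bar>Im t\<bar> < d}"
  define f where "f t = (\<Sum>i\<in>J. \<Sum>j\<in>J. A i j * F (line_dist2 (a i) (b i) t) * F (line_dist2 (a j) (b j) t))" for t
  have fH: "f holomorphic_on H" unfolding f_def H_def
    by (intro holomorphic_intros branch_comp_holomorphic_on_horizontal_strip[OF F]) (use J d in auto)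
  have H: "open H" "connected H"
    unfolding H_def by (auto intro: open_horizontal_strip convex_connected convex_horizontal_strip)
  have "countable {x::real. f (of_real x) = 0}"
  proof (cases "f constant_on H")
    case False
    have "countable {z \<in> H. f z = 0}"
      by (rule holomorphic_countable_zeros) (use fH H False fsigma_horizontal_strip in \<open>auto simp: H_def\<close>)
    moreover have "of_real ` {x::real. f (of_real x) = 0} \<subseteq> {z \<in> H. f z = 0}" using d by (auto simp: H_def)
    ultimately have "countable (complex_of_real ` {x::real. f (of_real x) = 0})"
      by (rule countable_subset[rotated])
    then show ?thesis by (rule countable_image_inj_on) (auto simp: inj_on_def)
  next
    case True
    then obtain c where c: "\<And>z. z \<in> H \<Longrightarrow> f z = c" by (auto simp: constant_on_def)
    then have fc: "f (of_real x) = c" for x :: real using d by (auto simp: H_def)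
    have "c \<noteq> 0"
    proof
      assume "c = 0"
      have "A i j = 0"
        by (rule translates_quadratically_independent[OF bj bj' J sym])
          (use fc nz \<open>c = 0\<close> in \<open>auto simp: f_def\<close>)
      with nz show False by simp
    qed
    then show ?thesis using fc by simp
  qed
  then show ?thesis by (simp add: f_def)
qed

section \<open>From lines to almost every point of the space\<close>

lemma AE_lborel_if_negligible:
  "negligible S \<Longrightarrow> AE z in lborel. z \<notin> S"
  using AE_not_in[of S lebesgue] AE_completion_iff[of "\<lambda>z. z \<notin> S" lborel]
  by (simp add: negligible_iff_null_sets)

text \<open>Fubini in the form of averaging over translations: for some time \<open>t\<close> the property holds at
  \<open>z + t *\<^sub>R e\<close> for almost every \<open>z\<close>, and Lebesgue measure is invariant under that translation.\<close>

lemma AE_lborel_along_lines: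
  fixes e :: "'a::euclidean_space"
  assumes [measurable]: "Measurable.pred borel P"
    and ae: "AE z in lborel. AE t in lborel. P (z + t *\<^sub>R e)"
  shows "AE z in lborel. P z"
proof -
  have "{x \<in> space ((lborel :: 'a measure) \<Otimes>\<^sub>M (lborel :: real measure)). P (fst x + snd x *\<^sub>R e)}
      \<in> sets (lborel \<Otimes>\<^sub>M lborel)" by measurable
  then have "AE t in lborel. AE z in lborel. P (z + t *\<^sub>R e)"
    using ae lborel_pair.AE_commute[of "\<lambda>z t. P (z + t *\<^sub>R e)"] by blast
  moreover have "ae_filter (lborel :: real measure) \<noteq> bot"
    by (simp add: ae_filter_eq_bot_iff)
  ultimately obtain t where "AE z in lborel. P (z + t *\<^sub>R e)"
    using eventually_happens' by blast
  then have "AE z in distr lborel borel ((+) (t *\<^sub>R e)). P z"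
    by (subst AE_distr_iff) (auto simp: add.commute)
  then show ?thesis unfolding lborel_distr_plus .
qed

text \<open>The directions that identify two of the points lie in finitely many hyperplanes.\<close>

lemma separating_direction:
  fixes x :: "'i \<Rightarrow> 'a::euclidean_space"
  assumes "finite J" "inj_on x J"
  obtains e where "norm e = 1" "inj_on (\<lambda>i. inner e (x i)) J"
proof -
  define B where "B = {0} \<union> (\<Union>(i, j)\<in>{(i, j). i \<in> J \<and> j \<in> J \<and> i \<noteq> j}. {v. inner (x i - x j) v = 0})"
  have "finite {(i, j). i \<in> J \<and> j \<in> J \<and> i \<noteq> j}"
    by (rule finite_subset[of _ "J \<times> J"]) (use assms in auto)
  then have "negligible B" unfolding B_def
    using assms by (intro negligible_Un negligible_Union) (auto intro!: negligible_hyperplane simp: inj_on_def)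
  then have "B \<noteq> UNIV" using non_negligible_UNIV by metis
  then obtain v where v: "v \<notin> B" by auto
  show ?thesis
  proof
    show "norm (v /\<^sub>R norm v) = 1" using v by (simp add: B_def)
    show "inj_on (\<lambda>i. inner (v /\<^sub>R norm v) (x i)) J"
    proof (rule inj_onI, rule ccontr)
      fix i j assume ij: "i \<in> J" "j \<in> J" "inner (v /\<^sub>R norm v) (x i) = inner (v /\<^sub>R norm v) (x j)" "i \<noteq> j"
      then have "inner v (x i) = inner v (x j)" using v by (simp add: B_def)
      then have "inner (x i - x j) v = 0" by (simp add: inner_diff_right inner_commute[of _ v])
      then show False using v ij by (auto simp: B_def)
    qed
  qed
qed

lemma AE_not_on_line:
  fixes y e :: "'a::euclidean_space"
  assumes "DIM('a) \<ge> 2"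
  shows "AE z in lborel. y - z \<notin> span {e}"
proof -
  have "dim (span {e}) < DIM('a)" using assms by (simp add: dim_singleton)
  then have "negligible (span {e})" by (rule negligible_lowdim)
  then have "negligible ((+) y ` span {e})" by (rule negligible_translation)
  then have "AE z in lborel. z \<notin> (+) y ` span {e}" by (rule AE_lborel_if_negligible)
  then show ?thesis
  proof eventually_elim
    case (elim z)
    have "z - y \<notin> span {e}" using elim by (metis add.commute diff_add_cancel image_eqI)
    then show ?case using span_neg[of "y - z" "{e}"] by auto
  qed
qed

lemma norm_line_sq:
  fixes z y e :: "'a::real_inner"
  assumes "norm e = 1"
  shows "(norm (z + t *\<^sub>R e - y))\<^sup>2 = (t - inner e (y - z))\<^sup>2 + (norm ((y - z) - (inner e (y - z)) *\<^sub>R e))\<^sup>2"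
proof -
  have ee: "inner e e = 1" using assms by (simp add: dot_square_norm)
  define v where "v = y - z"
  have "(norm (z + t *\<^sub>R e - y))\<^sup>2 = (norm (t *\<^sub>R e - v))\<^sup>2" by (simp add: v_def algebra_simps)
  also have "\<dots> = (t - inner e v)\<^sup>2 + (norm (v - inner e v *\<^sub>R e))\<^sup>2"
    unfolding power2_norm_eq_inner
    by (simp add: inner_diff inner_commute[of v e] ee power2_eq_square algebra_simps)
  finally show ?thesis by (simp only: v_def)
qed

text \<open>Choose a direction in which all the points have distinct projections. In dimension at least two
  almost every line in this direction misses all the points, and on such a line the squared distances
  have the form \<^const>\<open>line_dist2\<close> with distinct positions and positive heights.\<close>

lemma AE_quadratic_form_nonzero:
  fixes x :: "'i \<Rightarrow> 'a::euclidean_space" and A :: "'i \<Rightarrow> 'i \<Rightarrow> real"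
  assumes bj: "branch_jump F P N" and bj': "branch_jump (\<lambda>z. P z + N z) P' N'"
    and F: "\<And>r::real. r > 0 \<Longrightarrow> F (of_real (r\<^sup>2)) = of_real (\<psi> r)"
    and [measurable]: "\<psi> \<in> borel_measurable borel"
    and dim: "DIM('a) \<ge> 2"
    and J: "finite J" "inj_on x J"
    and sym: "\<And>i j. i \<in> J \<Longrightarrow> j \<in> J \<Longrightarrow> A i j = A j i"
    and nz: "i \<in> J" "j \<in> J" "A i j \<noteq> 0"
  shows "AE z in lborel. (\<Sum>i\<in>J. \<Sum>j\<in>J. A i j * \<psi> (norm (z - x i)) * \<psi> (norm (z - x j))) \<noteq> 0"
proof -
  obtain e where e: "norm e = 1" "inj_on (\<lambda>i. inner e (x i)) J"
    using separating_direction[OF J] by blast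
  define Q where "Q z = (\<Sum>i\<in>J. \<Sum>j\<in>J. A i j * \<psi> (norm (z - x i)) * \<psi> (norm (z - x j)))" for z
  have [measurable]: "Q \<in> borel_measurable borel" unfolding Q_def by measurable
  have "AE z in lborel. \<forall>i\<in>J. x i - z \<notin> span {e}"
    by (intro AE_finite_allI J(1) AE_not_on_line dim)
  then have "AE z in lborel. AE t in lborel. Q (z + t *\<^sub>R e) \<noteq> 0"
  proof eventually_elim
    case (elim z)
    \<comment> \<open>\<open>x i\<close> projects onto the line at time \<open>a i\<close> and lies at distance \<open>b i\<close> from it.\<close>
    define a where "a i = inner e (x i - z)" for i
    define b where "b i = norm ((x i - z) - a i *\<^sub>R e)" for i
    have b: "b i > 0" if "i \<in> J" for i
    proof -
      have "x i - z \<noteq> a i *\<^sub>R e" using elim that by (metis insertI1 span_base span_mul)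
      then show ?thesis by (simp add: b_def)
    qed
    have F': "F (line_dist2 (a i) (b i) (of_real t)) = of_real (\<psi> (norm (z + t *\<^sub>R e - x i)))"
      if "i \<in> J" for i t
    proof -
      have *: "(norm (z + t *\<^sub>R e - x i))\<^sup>2 = (t - a i)\<^sup>2 + (b i)\<^sup>2"
        unfolding a_def b_def by (rule norm_line_sq[OF e(1)])
      have "(norm (z + t *\<^sub>R e - x i))\<^sup>2 > 0"
        unfolding * using b[OF that] by (simp add: add_nonneg_pos)
      then have "norm (z + t *\<^sub>R e - x i) > 0" by auto
      then show ?thesis using F[of "norm (z + t *\<^sub>R e - x i)"] by (simp only: line_dist2_of_real *)
    qed
    have "countable {t::real. (\<Sum>i\<in>J. \<Sum>j\<in>J. of_real (A i j) * F (line_dist2 (a i) (b i) t) * F (line_dist2 (a j) (b j) t)) = 0}"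
    proof (rule countable_zeros_on_line[OF bj bj' J(1) _ b])
      show "inj_on a J" using e(2) by (simp add: a_def inj_on_def inner_diff_right)
    qed (use sym nz in auto)
    also have "{t::real. (\<Sum>i\<in>J. \<Sum>j\<in>J. of_real (A i j) * F (line_dist2 (a i) (b i) t) * F (line_dist2 (a j) (b j) t)) = 0}
       = {t. Q (z + t *\<^sub>R e) = 0}"
    proof (rule Collect_cong)
      fix t
      have "(\<Sum>i\<in>J. \<Sum>j\<in>J. of_real (A i j) * F (line_dist2 (a i) (b i) t) * F (line_dist2 (a j) (b j) t))
         = complex_of_real (Q (z + t *\<^sub>R e))"
        by (simp add: Q_def F' cong: sum.cong)
      then show "((\<Sum>i\<in>J. \<Sum>j\<in>J. of_real (A i j) * F (line_dist2 (a i) (b i) t) * F (line_dist2 (a j) (b j) t)) = 0)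
        = (Q (z + t *\<^sub>R e) = 0)" by (simp only: of_real_eq_0_iff)
    qed
    finally have "{t. Q (z + t *\<^sub>R e) = 0} \<in> null_sets lborel"
      by (rule countable_imp_null_set_lborel)
    from AE_not_in[OF this] show ?case by simp
  qed
  then have "AE z in lborel. Q z \<noteq> 0"
    by (rule AE_lborel_along_lines[rotated]) measurable
  then show ?thesis by (simp add: Q_def)
qed

lemma AE_dist_notin_finite:
  fixes y :: "'a::euclidean_space"
  assumes "finite Z"
  shows "AE z in lborel. norm (z - y) \<notin> Z"
proof -
  have "negligible (\<Union>r\<in>Z. sphere y r)"
    using assms by (auto intro: negligible_sphere)
  from AE_lborel_if_negligible[OF this] show ?thesis
    by (auto simp: dist_norm norm_minus_commute)
qed

section \<open>Invertibility of a bordered matrix\<close>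

lemma invertible_mat_iff_det:
  fixes V :: "'f::field mat"
  assumes V: "V \<in> carrier_mat n n"
  shows "invertible_mat V \<longleftrightarrow> det V \<noteq> 0"
proof
  assume "invertible_mat V"
  then obtain B where VB: "V * B = 1\<^sub>m n" and BV: "B * V = 1\<^sub>m (dim_row B)"
    using V by (auto simp: invertible_mat_def inverts_mat_def)
  have "dim_col B = n" using VB by (metis index_mult_mat(3) index_one_mat(3))
  moreover have "dim_row B = n" using BV V by (metis carrier_matD(2) index_mult_mat(3) index_one_mat(3))
  ultimately have "B \<in> carrier_mat n n" by auto
  then show "det V \<noteq> 0" using det_mult[OF V, of B] VB by auto
next
  assume "det V \<noteq> 0"
  then have "V \<in> Units (ring_mat TYPE('f) n ())" by (rule det_non_zero_imp_unit[OF V])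
  then obtain B where "B \<in> carrier_mat n n" "V * B = 1\<^sub>m n" "B * V = 1\<^sub>m n"
    by (auto simp: Units_def ring_mat_def)
  then show "invertible_mat V" using V
    by (auto simp: invertible_mat_def inverts_mat_def square_mat.simps intro!: exI[of _ B])
qed

lemma invertible_matI_kernel:
  fixes K :: "nat \<Rightarrow> nat \<Rightarrow> 'f::field"
  assumes "\<And>u i. (\<And>k. k < n \<Longrightarrow> (\<Sum>j<n. K k j * u j) = 0) \<Longrightarrow> i < n \<Longrightarrow> u i = 0"
  shows "invertible_mat (mat n n (\<lambda>(i, j). K i j))"
proof -
  let ?V = "mat n n (\<lambda>(i, j). K i j)"
  have "det ?V \<noteq> 0"
  proof
    assume "det ?V = 0"
    then obtain v where v: "v \<in> carrier_vec n" "v \<noteq> 0\<^sub>v n" "?V *\<^sub>v v = 0\<^sub>v n"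
      using det_0_iff_vec_prod_zero_field[of ?V n] by auto
    have "(\<Sum>j<n. K k j * vec_index v j) = 0" if "k < n" for k
    proof -
      have "vec_index (?V *\<^sub>v v) k = (\<Sum>j<n. K k j * vec_index v j)"
        using that v(1) by (auto simp: scalar_prod_def lessThan_atLeast0 intro!: sum.cong)
      then show ?thesis using v(3) that by simp
    qed
    then have "v = 0\<^sub>v n" using assms[of "\<lambda>j. vec_index v j"] v(1) by (intro eq_vecI) auto
    with v(2) show False ..
  qed
  then show ?thesis by (subst invertible_mat_iff_det[of _ n]) auto
qed

text \<open>The inverse is given by its entries as a function of two indices, the form in which the quadratic
  form of the previous section takes its coefficients.\<close>

lemma symmetric_inverse:
  fixes K :: "nat \<Rightarrow> nat \<Rightarrow> 'f::field"
  assumes inv: "invertible_mat (mat n n (\<lambda>(i, j). K i j))"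
    and sym: "\<And>i j. i < n \<Longrightarrow> j < n \<Longrightarrow> K i j = K j i"
  obtains W where "\<And>i j. i < n \<Longrightarrow> j < n \<Longrightarrow> W i j = W j i"
    and "\<And>i j. i < n \<Longrightarrow> j < n \<Longrightarrow> (\<Sum>k<n. W i k * K k j) = (if i = j then 1 else 0)"
proof -
  let ?V = "mat n n (\<lambda>(i, j). K i j)"
  have V: "?V \<in> carrier_mat n n" by simp
  have "det ?V \<noteq> 0" using inv invertible_mat_iff_det[OF V] by simp
  then have "?V \<in> Units (ring_mat TYPE('f) n ())" by (rule det_non_zero_imp_unit[OF V])
  then obtain B where B: "B \<in> carrier_mat n n" "?V * B = 1\<^sub>m n" "B * ?V = 1\<^sub>m n"
    by (auto simp: Units_def ring_mat_def)
  have VT: "transpose_mat ?V = ?V" by (rule eq_matI) (auto simp: sym)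
  have "transpose_mat B * ?V = transpose_mat (?V * B)"
    using transpose_mult[OF V B(1)] VT by simp
  then have TB: "transpose_mat B * ?V = 1\<^sub>m n" using B(2) by simp
  have "transpose_mat B = transpose_mat B * (?V * B)" using B by simp
  also have "\<dots> = (transpose_mat B * ?V) * B"
    using B(1) by (intro assoc_mult_mat[symmetric, of _ n n _ n _ n]) auto
  also have "\<dots> = B" using TB B(1) by simp
  finally have BT: "transpose_mat B = B" .
  show ?thesis
  proof
    show "B $$ (i, j) = B $$ (j, i)" if "i < n" "j < n" for i j
      using that B(1) BT by (metis carrier_matD index_transpose_mat(1))
    show "(\<Sum>k<n. B $$ (i, k) * K k j) = (if i = j then 1 else 0)" if "i < n" "j < n" for i j
    proof -
      have "(B * ?V) $$ (i, j) = (\<Sum>k<n. B $$ (i, k) * K k j)"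
        using that B(1) by (auto simp: scalar_prod_def lessThan_atLeast0 intro!: sum.cong)
      then show ?thesis using B(3) that by simp
    qed
  qed
qed

text \<open>For a kernel vector \<open>u\<close> of the bordered matrix the first \<open>n\<close> equations express \<open>u\<close> through its
  last entry \<open>u n\<close>; the last equation then says that \<open>u n\<close> times the quadratic form of the inverse, taken
  at the border, is zero. This form is the Schur complement up to sign.\<close>

lemma invertible_mat_bordered:
  fixes K :: "nat \<Rightarrow> nat \<Rightarrow> 'f::field"
  assumes W: "\<And>i j. i < n \<Longrightarrow> j < n \<Longrightarrow> (\<Sum>k<n. W i k * K k j) = (if i = j then 1 else 0)"
    and K: "K n n = 0" "\<And>i. i < n \<Longrightarrow> K n i = K i n"
    and nz: "(\<Sum>i<n. \<Sum>j<n. W i j * K i n * K j n) \<noteq> 0"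
  shows "invertible_mat (mat (Suc n) (Suc n) (\<lambda>(i, j). K i j))"
proof (rule invertible_matI_kernel)
  fix u :: "nat \<Rightarrow> 'f" and i
  assume ker: "\<And>k. k < Suc n \<Longrightarrow> (\<Sum>j<Suc n. K k j * u j) = 0" and i: "i < Suc n"
  have u: "u i = - u n * (\<Sum>k<n. W i k * K k n)" if i: "i < n" for i
  proof -
    have "0 = (\<Sum>k<n. W i k * (\<Sum>j<Suc n. K k j * u j))" using ker by simp
    also have "\<dots> = (\<Sum>k<n. \<Sum>j<n. W i k * K k j * u j) + (\<Sum>k<n. W i k * K k n * u n)"
      by (simp add: algebra_simps sum.distrib sum_distrib_left)
    also have "(\<Sum>k<n. \<Sum>j<n. W i k * K k j * u j) = (\<Sum>j<n. (\<Sum>k<n. W i k * K k j) * u j)"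
      by (subst sum.swap) (simp add: sum_distrib_right)
    also have "\<dots> = (\<Sum>j<n. if i = j then u j else 0)"
      using W[OF i] by (intro sum.cong) auto
    also have "\<dots> = u i" using i by simp
    finally show ?thesis by (simp add: sum_distrib_left sum_distrib_right eq_neg_iff_add_eq_0 mult_ac sum_negf)
  qed
  have "0 = (\<Sum>j<n. K n j * u j)" using ker[of n] K(1) by simp
  also have "\<dots> = - u n * (\<Sum>i<n. \<Sum>j<n. W i j * K i n * K j n)"
    by (simp add: u K(2) sum_distrib_left sum_negf mult_ac)
  finally have "u n = 0" using nz by simp
  then show "u i = 0" using u i by (cases "i = n") auto
qed

lemma interpolation_matrix_eq:
  "interpolation_matrix \<psi> x n = mat n n (\<lambda>(i, j). \<psi> (norm (x i - x j)))"
  by (simp add: interpolation_matrix_def radial_translate_def)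

lemma interpolation_matrix_cong:
  "(\<And>i. i < n \<Longrightarrow> x i = y i) \<Longrightarrow> interpolation_matrix \<psi> x n = interpolation_matrix \<psi> y n"
  unfolding interpolation_matrix_eq by (rule cong_mat) auto

text \<open>Coinciding points give equal rows. Thus invertibility itself supplies the distinctness of the points
  that the next step needs.\<close>

lemma inj_on_if_invertible:
  assumes "invertible_mat (interpolation_matrix \<psi> x n)"
  shows "inj_on x {..<n}"
proof (rule inj_onI, rule ccontr)
  fix i j assume ij: "i \<in> {..<n}" "j \<in> {..<n}" "x i = x j" "i \<noteq> j"
  have V: "interpolation_matrix \<psi> x n \<in> carrier_mat n n" by (simp add: interpolation_matrix_eq)
  have "row (interpolation_matrix \<psi> x n) i = row (interpolation_matrix \<psi> x n) j"
    using ij by (intro eq_vecI) (auto simp: interpolation_matrix_eq)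
  then have "det (interpolation_matrix \<psi> x n) = 0"
    using det_identical_rows[OF V ij(4)] ij by auto
  then show False using assms invertible_mat_iff_det[OF V] by simp
qed

lemma measurable_det_interpolation_matrix:
  fixes f :: "nat \<Rightarrow> 'b \<Rightarrow> 'a::euclidean_space"
  assumes [measurable]: "\<psi> \<in> borel_measurable borel"
    and f: "\<And>i. i < n \<Longrightarrow> f i \<in> borel_measurable M"
  shows "(\<lambda>\<omega>. det (interpolation_matrix \<psi> (\<lambda>i. f i \<omega>) n)) \<in> borel_measurable M"
proof -
  have entry: "(\<lambda>\<omega>. interpolation_matrix \<psi> (\<lambda>i. f i \<omega>) n $$ (i, j)) \<in> borel_measurable M"
    if "i < n" "j < n" for i j
  proof -
    note [measurable] = f[OF that(1)] f[OF that(2)]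
    show ?thesis using that by (simp add: interpolation_matrix_eq)
  qed
  have eq: "(\<lambda>\<omega>. det (interpolation_matrix \<psi> (\<lambda>i. f i \<omega>) n)) = (\<lambda>\<omega>. \<Sum>p\<in>{p. p permutes {0..<n}}.
      signof p * (\<Prod>i = 0..<n. interpolation_matrix \<psi> (\<lambda>i. f i \<omega>) n $$ (i, p i)))"
    by (rule ext, rule det_def') (simp add: interpolation_matrix_eq)
  show ?thesis unfolding eq
  proof (intro borel_measurable_sum borel_measurable_times borel_measurable_prod borel_measurable_const entry)
    fix p i assume "p \<in> {p. p permutes {0..<n}}" "i \<in> {0..<n}"
    then show "i < n" "p i < n" using permutes_in_image[of p "{0..<n}" i] by auto
  qed
qed

section \<open>Adding random points one at a time\<close>

text \<open>By independence the law of the first \<open>n\<close> points together with the next one is a product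
  measure, and the law of the next point has a density; hence an event that for each position of the
  first points excludes only a Lebesgue null set of positions of the next point is almost sure. Both
  blocks are kept as functions on index sets, because \<^const>\<open>prob_space.indep_var\<close> relates variables with
  values in one type.\<close>

lemma (in prob_space) AE_next_point:
  fixes X :: "nat \<Rightarrow> 'a \<Rightarrow> 'b::euclidean_space"
  assumes ind: "indep_vars (\<lambda>_. borel) X UNIV"
    and dist: "distributed M lborel (X n) f"
    and R: "{p \<in> space (PiM {..<n} (\<lambda>_. borel) \<Otimes>\<^sub>M borel). R (fst p) (snd p)}
       \<in> sets (PiM {..<n} (\<lambda>_. borel) \<Otimes>\<^sub>M borel)"
    and ae: "\<And>x. AE z in lborel. R x z"
  shows "AE \<omega> in M. R (restrict (\<lambda>i. X i \<omega>) {..<n}) (X n \<omega>)"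
proof -
  let ?Y = "\<lambda>\<omega>. restrict (\<lambda>i. X i \<omega>) {..<n}"
  let ?S = "PiM {..<n} (\<lambda>_. borel :: 'b measure)"
  let ?T = "PiM {n} (\<lambda>_. borel :: 'b measure)"
  let ?Z = "\<lambda>\<omega>. restrict (\<lambda>i. X i \<omega>) {n}"
  have iv: "indep_var ?S ?Y ?T ?Z"
    by (rule indep_var_restrict[OF ind]) auto
  then have Y: "?Y \<in> measurable M ?S" and Z: "?Z \<in> measurable M ?T"
    and prod: "distr M ?S ?Y \<Otimes>\<^sub>M distr M ?T ?Z = distr M (?S \<Otimes>\<^sub>M ?T) (\<lambda>\<omega>. (?Y \<omega>, ?Z \<omega>))"
    by (simp_all add: indep_var_distribution_eq)
  interpret Y: prob_space "distr M ?S ?Y" by (rule prob_space_distr[OF Y])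
  interpret Z: prob_space "distr M ?T ?Z" by (rule prob_space_distr[OF Z])
  interpret YZ: pair_sigma_finite "distr M ?S ?Y" "distr M ?T ?Z" ..
  have f: "f \<in> borel_measurable lborel" and d: "distr M lborel (X n) = density lborel f"
    and X: "X n \<in> measurable M lborel"
    using dist by (auto simp: distributed_def)
  have aeX: "AE \<omega> in M. R x (X n \<omega>)" for x
  proof -
    have "AE z in distr M lborel (X n). R x z"
      unfolding d AE_density[OF f] using ae[of x] by eventually_elim simp
    then show ?thesis by (rule AE_distrD[OF X])
  qed
  have comp: "(\<lambda>z. z n) \<in> measurable ?T borel" by (rule measurable_component_singleton) simp
  have pair: "(\<lambda>p. (fst p, snd p n)) \<in> measurable (?S \<Otimes>\<^sub>M ?T) (?S \<Otimes>\<^sub>M borel)"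
    by (intro measurable_Pair measurable_fst measurable_compose[OF measurable_snd comp])
  have R': "{p \<in> space (?S \<Otimes>\<^sub>M ?T). R (fst p) (snd p n)} \<in> sets (?S \<Otimes>\<^sub>M ?T)"
  proof -
    have "(\<lambda>p. (fst p, snd p n)) -` {p \<in> space (?S \<Otimes>\<^sub>M borel). R (fst p) (snd p)} \<inter> space (?S \<Otimes>\<^sub>M ?T)
        \<in> sets (?S \<Otimes>\<^sub>M ?T)" by (rule measurable_sets[OF pair R])
    also have "(\<lambda>p. (fst p, snd p n)) -` {p \<in> space (?S \<Otimes>\<^sub>M borel). R (fst p) (snd p)} \<inter> space (?S \<Otimes>\<^sub>M ?T)
        = {p \<in> space (?S \<Otimes>\<^sub>M ?T). R (fst p) (snd p n)}"
      using measurable_space[OF pair] by auto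
    finally show ?thesis .
  qed
  have slice: "{z \<in> space ?T. R x (z n)} \<in> sets ?T" if "x \<in> space ?S" for x
  proof -
    have "Pair x -` {p \<in> space (?S \<Otimes>\<^sub>M ?T). R (fst p) (snd p n)} \<in> sets ?T"
      by (rule sets_Pair1[OF R'])
    also have "Pair x -` {p \<in> space (?S \<Otimes>\<^sub>M ?T). R (fst p) (snd p n)} = {z \<in> space ?T. R x (z n)}"
      using that by (auto simp: space_pair_measure)
    finally show ?thesis .
  qed
  have aeT: "AE z in distr M ?T ?Z. R x (z n)" if "x \<in> space ?S" for x
    using aeX[of x] by (subst AE_distr_iff[OF Z slice[OF that]]) simp
  have "AE x in distr M ?S ?Y. AE z in distr M ?T ?Z. R x (z n)"
    by (rule AE_I2) (simp add: aeT)
  then have "AE p in distr M ?S ?Y \<Otimes>\<^sub>M distr M ?T ?Z. R (fst p) (snd p n)"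
    using R' by (intro YZ.AE_pair_measure) (simp_all add: space_pair_measure cong: sets_pair_measure_cong)
  then have "AE p in distr M (?S \<Otimes>\<^sub>M ?T) (\<lambda>\<omega>. (?Y \<omega>, ?Z \<omega>)). R (fst p) (snd p n)"
    unfolding prod .
  then have "AE \<omega> in M. R (fst (?Y \<omega>, ?Z \<omega>)) (snd (?Y \<omega>, ?Z \<omega>) n)"
    by (rule AE_distrD[OF measurable_Pair[OF Y Z]])
  then show ?thesis by simp
qed

text \<open>As the profile vanishes at zero, the Schur complement of the enlarged matrix is a quadratic form with
  the inverse of the old matrix as coefficients. An inverse has a nonzero entry, so this form vanishes
  for almost no position of the new point.\<close>

lemma AE_invertible_next:
  fixes x :: "nat \<Rightarrow> 'a::euclidean_space"
  assumes bj: "branch_jump F P N" and bj': "branch_jump (\<lambda>z. P z + N z) P' N'"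
    and F: "\<And>r::real. r > 0 \<Longrightarrow> F (of_real (r\<^sup>2)) = of_real (\<psi> r)"
    and \<psi>: "\<psi> \<in> borel_measurable borel" "\<psi> 0 = 0"
    and dim: "DIM('a) \<ge> 2"
    and inv: "invertible_mat (interpolation_matrix \<psi> x n)" and n: "n > 0"
  shows "AE z in lborel. invertible_mat (interpolation_matrix \<psi> (x(n := z)) (Suc n))"
proof -
  obtain W where W: "\<And>i j. i < n \<Longrightarrow> j < n \<Longrightarrow> W i j = W j i"
    "\<And>i j. i < n \<Longrightarrow> j < n \<Longrightarrow> (\<Sum>k<n. W i k * \<psi> (norm (x k - x j))) = (if i = j then 1 else 0)"
  proof (rule symmetric_inverse[of n "\<lambda>i j. \<psi> (norm (x i - x j))"])
    show "invertible_mat (mat n n (\<lambda>(i, j). \<psi> (norm (x i - x j))))"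
      using inv by (simp add: interpolation_matrix_eq)
  qed (auto simp: norm_minus_commute)
  have "\<exists>k<n. W 0 k \<noteq> 0"
  proof (rule ccontr)
    assume "\<not> (\<exists>k<n. W 0 k \<noteq> 0)"
    then have "(\<Sum>k<n. W 0 k * \<psi> (norm (x k - x 0))) = 0" by simp
    then show False using W(2)[of 0 0] n by simp
  qed
  then obtain k where k: "k < n" "W 0 k \<noteq> 0" by blast
  have "AE z in lborel. (\<Sum>i<n. \<Sum>j<n. W i j * \<psi> (norm (z - x i)) * \<psi> (norm (z - x j))) \<noteq> 0"
    by (rule AE_quadratic_form_nonzero[OF bj bj' F \<psi>(1) dim _ inj_on_if_invertible[OF inv]])
      (use W k n in auto)
  then show ?thesis
  proof eventually_elim
    case (elim z)
    show ?case unfolding interpolation_matrix_eq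
      by (rule invertible_mat_bordered[where W = W])
        (use W elim \<psi>(2) in \<open>simp_all add: norm_minus_commute\<close>)
  qed
qed

text \<open>The induction has to start at two points: the matrix of a single point is zero. For two points
  the excluded positions form finitely many spheres about the first point.\<close>

lemma AE_invertible_two:
  fixes x :: "nat \<Rightarrow> 'a::euclidean_space"
  assumes \<psi>: "\<psi> 0 = 0" and fin: "finite {r. r \<ge> 0 \<and> \<psi> r = 0}"
  shows "AE z in lborel. invertible_mat (interpolation_matrix \<psi> (x(1 := z)) 2)"
proof -
  have "AE z in lborel. norm (z - x 0) \<notin> {r. r \<ge> 0 \<and> \<psi> r = 0}"
    by (rule AE_dist_notin_finite[OF fin])
  then show ?thesis
  proof eventually_elim
    case (elim z)
    then have nz: "\<psi> (norm (z - x 0)) \<noteq> 0" by simp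
    show ?case unfolding interpolation_matrix_eq
    proof (rule invertible_matI_kernel)
      fix u :: "nat \<Rightarrow> real" and i :: nat
      assume ker: "\<And>k. k < 2 \<Longrightarrow> (\<Sum>j<2. \<psi> (norm ((x(1 := z)) k - (x(1 := z)) j)) * u j) = 0" and i: "i < 2"
      have "u 1 = 0" "u 0 = 0"
        using ker[of 0] ker[of 1] nz \<psi> by (auto simp: lessThan_nat_numeral numeral_2_eq_2 norm_minus_commute)
      then show "u i = 0" using i by (cases "i = 0") (auto simp: less_2_cases_iff)
    qed
  qed
qed

lemma (in prob_space) AE_invertible_interpolation_matrix:
  fixes X :: "nat \<Rightarrow> 'a \<Rightarrow> 'b::euclidean_space"
  assumes bj: "branch_jump F P N" and bj': "branch_jump (\<lambda>z. P z + N z) P' N'"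
    and F: "\<And>r::real. r > 0 \<Longrightarrow> F (of_real (r\<^sup>2)) = of_real (\<psi> r)"
    and \<psi>: "\<psi> \<in> borel_measurable borel" "\<psi> 0 = 0" "finite {r. r \<ge> 0 \<and> \<psi> r = 0}"
    and dim: "DIM('b) \<ge> 2"
    and ind: "indep_vars (\<lambda>_. borel) X UNIV"
    and dist: "\<And>i. distributed M lborel (X i) f"
    and n: "n \<ge> 2"
  shows "AE \<omega> in M. invertible_mat (interpolation_matrix \<psi> (\<lambda>i. X i \<omega>) n)"
proof -
  \<comment> \<open>\<open>Q\<close> is invertibility of the previous matrix, except for two points, where nothing is required of the first.\<close>
  have extend: "AE \<omega> in M. invertible_mat (interpolation_matrix \<psi> (\<lambda>i. X i \<omega>) (Suc n))"
    if "AE \<omega> in M. Q (restrict (\<lambda>i. X i \<omega>) {..<n})"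
      and Q: "{x \<in> space (PiM {..<n} (\<lambda>_. borel)). Q x} \<in> sets (PiM {..<n} (\<lambda>_. borel))"
      and ae: "\<And>x. Q x \<Longrightarrow> AE z in lborel. invertible_mat (interpolation_matrix \<psi> (x(n := z)) (Suc n))" for n Q
  proof -
    let ?S = "PiM {..<n} (\<lambda>_. borel :: 'b measure)"
    \<comment> \<open>The event asks for invertibility only where \<open>Q\<close> holds, so that every position \<open>x\<close> excludes a null set.\<close>
    define R where "R x z \<longleftrightarrow> Q x \<longrightarrow> det (interpolation_matrix \<psi> (x(n := z)) (Suc n)) \<noteq> 0" for x z
    have inv_iff: "invertible_mat (interpolation_matrix \<psi> x m) \<longleftrightarrow> det (interpolation_matrix \<psi> x m) \<noteq> 0" for m and x :: "nat \<Rightarrow> 'b"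
      by (rule invertible_mat_iff_det[of _ m]) (simp add: interpolation_matrix_eq)
    have "AE \<omega> in M. R (restrict (\<lambda>i. X i \<omega>) {..<n}) (X n \<omega>)"
    proof (rule AE_next_point[OF ind dist])
      show "AE z in lborel. R x z" for x
        using ae[of x] by (cases "Q x") (auto simp: R_def inv_iff)
      have [measurable]: "Measurable.pred ?S Q" using Q by (simp add: pred_def)
      have "(\<lambda>p. det (interpolation_matrix \<psi> (\<lambda>i. ((fst p)(n := snd p)) i) (Suc n)))
         \<in> borel_measurable (?S \<Otimes>\<^sub>M borel)"
      proof (rule measurable_det_interpolation_matrix[OF \<psi>(1)])
        fix i assume i: "i < Suc n"
        show "(\<lambda>p. ((fst p)(n := snd p)) i) \<in> borel_measurable (?S \<Otimes>\<^sub>M borel)"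
        proof (cases "i = n")
          case False
          then have "(\<lambda>x. x i) \<in> borel_measurable ?S" using i by (intro measurable_component_singleton) auto
          from measurable_compose[OF measurable_fst this] show ?thesis using False by simp
        qed simp
      qed
      then have [measurable]: "(\<lambda>p. det (interpolation_matrix \<psi> ((fst p)(n := snd p)) (Suc n)))
         \<in> borel_measurable (?S \<Otimes>\<^sub>M borel)" .
      show "{p \<in> space (?S \<Otimes>\<^sub>M borel). R (fst p) (snd p)} \<in> sets (?S \<Otimes>\<^sub>M borel)"
        unfolding R_def by measurable
    qed
    with that(1) show ?thesis
    proof eventually_elim
      case (elim \<omega>)
      then have "det (interpolation_matrix \<psi> ((restrict (\<lambda>i. X i \<omega>) {..<n})(n := X n \<omega>)) (Suc n)) \<noteq> 0"
        by (simp add: R_def)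
      also have "interpolation_matrix \<psi> ((restrict (\<lambda>i. X i \<omega>) {..<n})(n := X n \<omega>)) (Suc n)
          = interpolation_matrix \<psi> (\<lambda>i. X i \<omega>) (Suc n)"
        by (rule interpolation_matrix_cong) auto
      finally show ?case by (simp add: inv_iff)
    qed
  qed
  show ?thesis using n
  proof (induction n rule: dec_induct)
    case base
    have "AE \<omega> in M. invertible_mat (interpolation_matrix \<psi> (\<lambda>i. X i \<omega>) (Suc 1))"
      by (rule extend[of "\<lambda>_. True" 1])
        (use AE_invertible_two[OF \<psi>(2,3)] in \<open>simp_all add: numeral_2_eq_2\<close>)
    then show ?case by (simp add: numeral_2_eq_2)
  next
    case (step m)
    let ?Q = "\<lambda>x :: nat \<Rightarrow> 'b. invertible_mat (interpolation_matrix \<psi> x m)"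
    show ?case
    proof (rule extend[of ?Q m])
      have "interpolation_matrix \<psi> (restrict (\<lambda>i. X i \<omega>) {..<m}) m = interpolation_matrix \<psi> (\<lambda>i. X i \<omega>) m" for \<omega>
        by (rule interpolation_matrix_cong) auto
      then show "AE \<omega> in M. ?Q (restrict (\<lambda>i. X i \<omega>) {..<m})" using step.IH by simp
      have [measurable]: "(\<lambda>x. det (interpolation_matrix \<psi> x m)) \<in> borel_measurable (PiM {..<m} (\<lambda>_. borel :: 'b measure))"
        by (rule measurable_det_interpolation_matrix[OF \<psi>(1), of m "\<lambda>i x. x i"])
          (simp add: measurable_component_singleton)
      have inv_iff: "?Q x \<longleftrightarrow> det (interpolation_matrix \<psi> x m) \<noteq> 0" for x :: "nat \<Rightarrow> 'b"
        by (rule invertible_mat_iff_det[of _ m]) (simp add: interpolation_matrix_eq)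
      show "{x \<in> space (PiM {..<m} (\<lambda>_. borel)). ?Q x} \<in> sets (PiM {..<m} (\<lambda>_. borel))"
        by (subst inv_iff) measurable
    qed (use step.hyps in \<open>intro AE_invertible_next[OF bj bj' F \<psi>(1,2) dim]; simp\<close>)
  qed
qed

section \<open>The two families of profiles\<close>

text \<open>The next two facts are \<open>sin (pi * \<mu>) \<noteq> 0\<close> and \<open>cos (pi * \<mu>) \<noteq> 0\<close>. With \<open>\<mu> = \<nu> / 2\<close> they say that \<open>\<nu>\<close> is
  neither an even nor an odd integer: the first makes the power jump across its cut, the second keeps
  the sum of its two boundary values different from zero.\<close>

lemma exp_i_pi_neq_exp_minus:
  assumes "\<mu> \<notin> \<int>" shows "exp (\<i> * pi * of_real \<mu>) \<noteq> exp (- (\<i> * pi * of_real \<mu>))"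
proof
  assume "exp (\<i> * pi * of_real \<mu>) = exp (- (\<i> * pi * of_real \<mu>))"
  then obtain n :: int where n: "\<i> * pi * of_real \<mu> = - (\<i> * pi * of_real \<mu>) + of_int (2 * n) * pi * \<i>"
    unfolding exp_eq by (auto simp: algebra_simps)
  then have "pi * \<mu> = - (pi * \<mu>) + 2 * of_int n * pi" by (auto simp: complex_eq_iff)
  then have "pi * \<mu> = pi * of_int n" by (simp add: algebra_simps)
  then have "\<mu> = of_int n" using pi_neq_zero mult_cancel_left by blast
  with assms show False by simp
qed

lemma exp_i_pi_plus_exp_minus_neq_0:
  assumes "2 * \<mu> \<notin> \<int>" shows "exp (\<i> * pi * of_real \<mu>) + exp (- (\<i> * pi * of_real \<mu>)) \<noteq> 0"
proof
  assume "exp (\<i> * pi * of_real \<mu>) + exp (- (\<i> * pi * of_real \<mu>)) = 0"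
  then have "exp (\<i> * pi * of_real \<mu>) = - exp (- (\<i> * pi * of_real \<mu>))" by (simp add: add_eq_0_iff)
  then have "exp (\<i> * pi * of_real \<mu>) = exp (- (\<i> * pi * of_real \<mu>) + \<i> * pi)"
    by (simp only: exp_add exp_pi_i') simp
  then obtain n :: int where n: "\<i> * pi * of_real \<mu> = - (\<i> * pi * of_real \<mu>) + \<i> * pi + of_int (2 * n) * pi * \<i>"
    unfolding exp_eq by (auto simp: algebra_simps)
  then have "pi * \<mu> = - (pi * \<mu>) + pi + 2 * of_int n * pi" by (auto simp: complex_eq_iff)
  then have "pi * (2 * \<mu>) = pi * of_int (2 * n + 1)" by (simp add: algebra_simps)
  then have "2 * \<mu> = of_int (2 * n + 1)" using pi_neq_zero mult_cancel_left by blast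
  with assms show False by (metis Ints_of_int)
qed

lemma Ln_upper: "Im z > 0 \<Longrightarrow> Ln z = Ln (- z) + \<i> * pi"
  and Ln_lower: "Im z < 0 \<Longrightarrow> Ln z = Ln (- z) - \<i> * pi"
  using Ln_minus[of "- z"] by (auto simp: complex_eq_iff)

text \<open>The factor \<open>c\<close> makes the lemma apply also to the sum of the two continuations of a power, which is again
  a multiple of the same power.\<close>

lemma branch_jump_powr:
  assumes "c \<noteq> 0" "\<mu> \<notin> \<int>"
  shows "branch_jump (\<lambda>z. c * z powr of_real \<mu>)
           (\<lambda>w. c * exp (\<i> * pi * of_real \<mu>) * w powr of_real \<mu>)
           (\<lambda>w. c * exp (- (\<i> * pi * of_real \<mu>)) * w powr of_real \<mu>)"
  unfolding branch_jump_def
proof (intro conjI allI impI)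
  fix z :: complex
  assume "Im z > 0"
  moreover from this have "z \<noteq> 0" by auto
  ultimately show "c * z powr of_real \<mu> = c * exp (\<i> * pi * of_real \<mu>) * (- z) powr of_real \<mu>"
    by (simp add: powr_def Ln_upper[of z] exp_add[symmetric] algebra_simps)
next
  fix z :: complex
  assume "Im z < 0"
  moreover from this have "z \<noteq> 0" by auto
  ultimately show "c * z powr of_real \<mu> = c * exp (- (\<i> * pi * of_real \<mu>)) * (- z) powr of_real \<mu>"
    by (simp add: powr_def Ln_lower[of z] exp_add[symmetric] algebra_simps)
next
  fix m :: real assume "m > 0"
  then show "c * exp (\<i> * pi * of_real \<mu>) * complex_of_real m powr of_real \<mu>
     \<noteq> c * exp (- (\<i> * pi * of_real \<mu>)) * complex_of_real m powr of_real \<mu>"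
    using assms exp_i_pi_neq_exp_minus[of \<mu>] by (simp add: powr_def)
qed (auto intro!: holomorphic_intros)

text \<open>Again the factor \<open>c\<close> covers the sum of the two continuations: the terms with \<open>\<i> pi\<close> cancel in it.\<close>

lemma branch_jump_Ln:
  assumes "c \<noteq> 0"
  shows "branch_jump (\<lambda>z. c * z ^ k * Ln z) (\<lambda>w. c * (- w) ^ k * (Ln w + \<i> * pi)) (\<lambda>w. c * (- w) ^ k * (Ln w - \<i> * pi))"
  unfolding branch_jump_def
proof (intro conjI allI impI)
  fix m :: real assume "m > 0"
  then show "c * (- complex_of_real m) ^ k * (Ln m + \<i> * pi) \<noteq> c * (- complex_of_real m) ^ k * (Ln m - \<i> * pi)"
    using assms by (auto simp: algebra_simps complex_eq_iff)
next
  fix z :: complex assume "Im z > 0"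
  then show "c * z ^ k * Ln z = c * (- (- z)) ^ k * (Ln (- z) + \<i> * pi)"
    by (simp add: Ln_upper[of z])
next
  fix z :: complex assume "Im z < 0"
  then show "c * z ^ k * Ln z = c * (- (- z)) ^ k * (Ln (- z) - \<i> * pi)"
    by (simp add: Ln_lower[of z])
qed (auto intro!: holomorphic_intros)

lemma thin_plate_spline_branch:
  fixes r :: real assumes "r > 0"
  shows "1 / 2 * complex_of_real (r\<^sup>2) ^ k * Ln (of_real (r\<^sup>2)) = of_real (thin_plate_spline k r)"
proof -
  have "Ln (of_real (r\<^sup>2)) = complex_of_real (ln (r\<^sup>2))"
    using assms by (intro Ln_of_real) simp
  also have "ln (r\<^sup>2) = 2 * ln r" using assms by (simp add: ln_realpow)
  finally have Ln: "Ln (of_real (r\<^sup>2)) = complex_of_real (2 * ln r)" .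
  show ?thesis unfolding Ln using assms by (simp add: thin_plate_spline_def power_mult)
qed

lemma radial_power_branch:
  fixes r :: real assumes "r > 0"
  shows "1 * complex_of_real (r\<^sup>2) powr of_real (\<nu> / 2) = of_real (radial_power \<nu> r)"
proof -
  have "complex_of_real (r\<^sup>2) powr of_real (\<nu> / 2) = of_real ((r\<^sup>2) powr (\<nu> / 2))"
    by (rule powr_of_real) auto
  also have "(r\<^sup>2) powr (\<nu> / 2) = r powr \<nu>"
    using assms powr_powr[of r 2 "\<nu> / 2"] by (simp add: powr_numeral)
  finally show ?thesis by (simp add: radial_power_def)
qed

section \<open>Almost sure unisolvence\<close>

theorem theorem1:
  fixes M :: "'w measure"
    and X :: "nat \<Rightarrow> 'w \<Rightarrow> 'a :: euclidean_space"
    and \<Omega> :: "'a set"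
    and \<sigma> :: "'a \<Rightarrow> real"
    and \<phi> :: "real \<Rightarrow> real"
  assumes "DIM('a) \<ge> 2"
    and "open \<Omega>" and "connected \<Omega>"
    and "set_integrable lborel \<Omega> \<sigma>"
    and "AE x\<in>\<Omega> in lborel. \<sigma> x \<ge> 0"
    and "(LINT x:\<Omega>|lborel. \<sigma> x) = 1"
    and "prob_space M"
    and "\<And>i \<omega>. \<omega> \<in> space M \<Longrightarrow> X i \<omega> \<in> \<Omega>"
    and "prob_space.indep_vars M (\<lambda>_. borel) X UNIV"
    and "\<And>i. distributed M lborel (X i) (\<lambda>x. ennreal (indicator \<Omega> x * \<sigma> x))"
    and "(\<exists>k\<ge>1. \<forall>r\<ge>0. \<phi> r = thin_plate_spline k r) \<or>
         (\<exists>\<nu>>0. \<nu> \<notin> \<int> \<and> (\<forall>r\<ge>0. \<phi> r = radial_power \<nu> r))"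
  shows "\<forall>n\<ge>2. AE \<omega> in M. invertible_mat (interpolation_matrix \<phi> (\<lambda>i. X i \<omega>) n)"
proof (intro allI impI)
  fix n :: nat assume n: "2 \<le> n"
  interpret prob_space M by (rule assms(7))
  have transfer: "AE \<omega> in M. invertible_mat (interpolation_matrix \<phi> (\<lambda>i. X i \<omega>) n)"
    if "\<forall>r\<ge>0. \<phi> r = \<psi> r"
      and "AE \<omega> in M. invertible_mat (interpolation_matrix \<psi> (\<lambda>i. X i \<omega>) n)" for \<psi>
    using that by (simp add: interpolation_matrix_eq)
  from assms(11) show "AE \<omega> in M. invertible_mat (interpolation_matrix \<phi> (\<lambda>i. X i \<omega>) n)"
  proof
    assume "\<exists>k\<ge>1. \<forall>r\<ge>0. \<phi> r = thin_plate_spline k r"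
    then obtain k where k: "\<forall>r\<ge>0. \<phi> r = thin_plate_spline k r" by blast
    have jump: "branch_jump (\<lambda>z. 1 / 2 * z ^ k * Ln z)
        (\<lambda>w. 1 / 2 * (- w) ^ k * (Ln w + \<i> * pi)) (\<lambda>w. 1 / 2 * (- w) ^ k * (Ln w - \<i> * pi))"
      by (rule branch_jump_Ln) simp
    have "1 / 2 * (- w) ^ k * (Ln w + \<i> * pi) + 1 / 2 * (- w) ^ k * (Ln w - \<i> * pi)
        = (- 1) ^ k * w ^ k * Ln w" for w
    proof -
      have "1 / 2 * A * (L + c) + 1 / 2 * A * (L - c) = A * L" for A L c :: complex
        by (simp add: field_simps)
      then show ?thesis by (simp only: power_minus[of w k])
    qed
    then have jump_sum: "branch_jump (\<lambda>w. 1 / 2 * (- w) ^ k * (Ln w + \<i> * pi) + 1 / 2 * (- w) ^ k * (Ln w - \<i> * pi))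
        (\<lambda>w. (- 1) ^ k * (- w) ^ k * (Ln w + \<i> * pi)) (\<lambda>w. (- 1) ^ k * (- w) ^ k * (Ln w - \<i> * pi))"
      using branch_jump_Ln[of "(- 1) ^ k" k] by simp
    have meas: "thin_plate_spline k \<in> borel_measurable borel"
      unfolding thin_plate_spline_def by measurable
    have zeros: "finite {r. r \<ge> 0 \<and> thin_plate_spline k r = 0}"
      by (rule finite_subset[of _ "{0, 1}"]) (auto simp: thin_plate_spline_def)
    have "thin_plate_spline k 0 = 0" by (simp add: thin_plate_spline_def)
    from AE_invertible_interpolation_matrix[OF jump jump_sum thin_plate_spline_branch meas this zeros assms(1,9,10) n]
    show ?thesis by (rule transfer[OF k])
  next
    assume "\<exists>\<nu>>0. \<nu> \<notin> \<int> \<and> (\<forall>r\<ge>0. \<phi> r = radial_power \<nu> r)"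
    then obtain \<nu> where \<nu>: "\<nu> > 0" "\<nu> \<notin> \<int>" "\<forall>r\<ge>0. \<phi> r = radial_power \<nu> r" by blast
    define \<mu> where "\<mu> = \<nu> / 2"
    have \<mu>: "\<mu> \<notin> \<int>" "2 * \<mu> \<notin> \<int>"
      using \<nu>(2) Ints_mult[of 2 \<mu>] by (auto simp: \<mu>_def)
    let ?u = "exp (\<i> * pi * of_real \<mu>)" and ?v = "exp (- (\<i> * pi * of_real \<mu>))"
    have jump: "branch_jump (\<lambda>z. 1 * z powr of_real \<mu>) (\<lambda>w. 1 * ?u * w powr of_real \<mu>) (\<lambda>w. 1 * ?v * w powr of_real \<mu>)"
      by (rule branch_jump_powr) (use \<mu> in auto)
    have jump_sum: "branch_jump (\<lambda>w. 1 * ?u * w powr of_real \<mu> + 1 * ?v * w powr of_real \<mu>)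
        (\<lambda>w. (?u + ?v) * ?u * w powr of_real \<mu>) (\<lambda>w. (?u + ?v) * ?v * w powr of_real \<mu>)"
      using branch_jump_powr[OF exp_i_pi_plus_exp_minus_neq_0[OF \<mu>(2)] \<mu>(1)] by (simp only: distrib_right mult_1)
    have branch: "1 * complex_of_real (r\<^sup>2) powr of_real \<mu> = of_real (radial_power \<nu> r)" if "r > 0" for r :: real
      using radial_power_branch[OF that] by (simp only: \<mu>_def)
    have meas: "radial_power \<nu> \<in> borel_measurable borel"
      unfolding radial_power_def by measurable
    have zeros: "finite {r. r \<ge> 0 \<and> radial_power \<nu> r = 0}"
      by (rule finite_subset[of _ "{0}"]) (auto simp: radial_power_def)
    have "radial_power \<nu> 0 = 0" by (simp add: radial_power_def)
    from AE_invertible_interpolation_matrix[OF jump jump_sum branch meas this zeros assms(1,9,10) n]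
    show ?thesis by (rule transfer[OF \<nu>(3)])
  qed
qed

end
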